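(* Let $\varphi=(\varphi_1,\dots,\varphi_{\mathfrak{m}-n})\in C^\infty(B_r';\mathbb{R}^{\mathfrak{m}-n})$ and let $\mathbf{c}_2=(c_{1,2},\dots,c_{\mathfrak{m}-n,2})$ be the coefficient of $(y^n)^2$ in the formal series solution (described in the context) of the minimal surface system with leading term $\varphi$. Then for $s=1,\dots,\mathfrak{m}-n$, $$c_{s,2}(y')=\frac12\sqrt{1+|D\varphi_s(y')|^2}\,\bigl(H(y'),\nu_s(y')\bigr),$$ where $H(y')$ is the mean curvature vector, at the point $(y',0,\varphi(y'))$, of the graph $\Gamma=\{(y',0,\varphi(y')):y'\in B_r'\}$, and $\nu_s$ is the unit normal vector $$\nu_s=\frac{(-D\varphi_s,\mathbf{e}_s)}{\sqrt{1+|D\varphi_s|^2}}.$$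
   Context: Integers $n\geq2$, $\mathfrak{m}>n$. $B_r'=\{y'=(y^1,\dots,y^{n-1}):|y'|<r\}$; $B_r^+=\{(y',y^n):|y'|<r,\ 0<y^n<r\}$. The minimal surface system for $\mathbf{u}=(u_1,\dots,u_{\mathfrak{m}-n})$ on $B_r^+$ is $$g^{ij}\frac{\partial^2u_s}{\partial y^i\partial y^j}-\frac{n}{y^n}\frac{\partial u_s}{\partial y^n}=0,\quad s=1,\dots,\mathfrak{m}-n,\qquad (g^{ij})=(g_{ij})^{-1},\quad g_{ij}=\delta_{ij}+\sum_{l=1}^{\mathfrak{m}-n}\partial_iu_l\,\partial_ju_l.$$ Formal series solution: given smooth $\varphi$ and an arbitrary smooth $\mathbf{c}_{n+1,0}$ on $B_r'$, the unique formal series $$\mathbf{u}=\varphi+\sum_{i=2}^n\mathbf{c}_i(y')(y^n)^i+\sum_{i=n+1}^\infty\sum_{j=0}^{\lfloor(i-1)/n\rfloor}\mathbf{c}_{i,j}(y')(y^n)^i(\log y^n)^j$$ with smooth coefficients that formally solves the system (coefficients being determined by matching terms $(y^n)^i(\log y^n)^j$). The points $(y',0,\varphi(y'))$ are written in the ordering $(y^1,\dots,y^{n-1},y^n,\text{remaining }\mathfrak{m}-n\text{ coordinates})$ of $\mathbb{R}^{\mathfrak{m}}$; $\Gamma$ is regarded as an $(n-1)$-dimensional submanifold of $\{y^n=0\}\cong\mathbb{R}^{\mathfrak{m}-1}$ with Euclidean metric. Its mean curvature vector is $H=\frac{1}{n-1}g^{\alpha\beta}\operatorname{II}_{\alpha\beta}$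 (sum over $1\le\alpha,\beta\le n-1$; average of principal traces of the vector-valued second fundamental form $\operatorname{II}$). $(\cdot,\cdot)$ is the Euclidean inner product, and $\mathbf{e}_s$ is the $s$-th standard basis vector of $\mathbb{R}^{\mathfrak{m}-n}$. *)

theory Defs
  imports "HOL-Analysis.Analysis" "HOL-Computational_Algebra.Formal_Laurent_Series"
begin

text \<open>
  The index type \<open>'p\<close> numbers the coordinates $y^1,\dots,y^{n-1}$ of $y'$, so that
  \<open>CARD('p)\<close> is $n-1$; \<open>'p option\<close> numbers $y^1,\dots,y^n$, with \<open>None\<close> standing for the
  distinguished coordinate $y^n$; \<open>'k\<close> numbers the $m-n$ components of the unknown.
\<close>

definition partial_deriv :: "'p \<Rightarrow> (real ^ 'p::finite \<Rightarrow> 'b::real_normed_vector) \<Rightarrow> real ^ 'p \<Rightarrow> 'b"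
  where "partial_deriv \<alpha> f y = frechet_derivative f (at y) (axis \<alpha> 1)"

fun Ck_on :: "nat \<Rightarrow> 'a::real_normed_vector set \<Rightarrow> ('a \<Rightarrow> 'b::real_normed_vector) \<Rightarrow> bool"
  where
    "Ck_on 0 S f \<longleftrightarrow> continuous_on S f"
  | "Ck_on (Suc k) S f \<longleftrightarrow>
       (\<forall>y\<in>S. f differentiable (at y)) \<and>
       (\<forall>v. Ck_on k S (\<lambda>y. frechet_derivative f (at y) v))"

text \<open>The set \<open>S\<close> is meant to be open.\<close>

definition smooth_on :: "'a::real_normed_vector set \<Rightarrow> ('a \<Rightarrow> 'b::real_normed_vector) \<Rightarrow> bool"
  where "smooth_on S f \<longleftrightarrow> (\<forall>k. Ck_on k S f)"


section \<open>Formal series in $t = y^n$ and $\log t$\<close>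

text \<open>
  At a fixed $y'$, a formal series $\sum_{i,j} a_{i,j}\, t^i (\log t)^j$, with finitely many $j$
  for each $i$, is an element of \<open>real poly fls\<close>: the Laurent variable is $t$ and the polynomial
  variable is $L = \log t$, treated as an independent symbol (this is what matching the terms
  $t^i(\log t)^j$ amounts to). A formal series with coefficients depending on $y'$ is a function
  \<open>real ^ 'p \<Rightarrow> real poly fls\<close>.

  In the direction $y^n$, the rule is
  $\partial_t (p(L)\, t^i) = (i\, p(L) + p'(L))\, t^{i-1}$; in the other directions the
  coefficients are differentiated.
\<close>

definition formal_partial ::
    "'p option \<Rightarrow> (real ^ 'p::finite \<Rightarrow> real poly fls) \<Rightarrow> real ^ 'p \<Rightarrow> real poly fls"
  where "formal_partial i F y =
    (case i of
       None \<Rightarrow> Abs_fls (\<lambda>k. of_int (k + 1) * fls_nth (F y) (k + 1) + pderiv (fls_nth (F y) (k + 1)))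
     | Some \<alpha> \<Rightarrow> Abs_fls (\<lambda>k. Abs_poly (\<lambda>j. partial_deriv \<alpha> (\<lambda>z. coeff (fls_nth (F z) k) j) y)))"

text \<open>
  The series
  $\varphi + \sum_{i=2}^n c_i\, t^i + \sum_{i>n} \sum_{j=0}^{\lfloor (i-1)/n\rfloor} d_{i,j}\, t^i L^j$,
  one component for each \<open>s\<close>.
\<close>

definition formal_series ::
    "nat \<Rightarrow> (real ^ 'p::finite \<Rightarrow> real ^ 'k::finite) \<Rightarrow> (nat \<Rightarrow> real ^ 'p \<Rightarrow> real ^ 'k)
      \<Rightarrow> (nat \<Rightarrow> nat \<Rightarrow> real ^ 'p \<Rightarrow> real ^ 'k) \<Rightarrow> 'k \<Rightarrow> real ^ 'p \<Rightarrow> real poly fls"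
  where "formal_series n \<phi> c d s y = fps_to_fls (Abs_fps (\<lambda>i.
    if i = 0 then [:\<phi> y $ s:]
    else if i = 1 then 0
    else if i \<le> n then [:c i y $ s:]
    else (\<Sum>j\<le>(i - 1) div n. monom (d i j y $ s) j)))"

definition formal_metric ::
    "('k::finite \<Rightarrow> real ^ 'p::finite \<Rightarrow> real poly fls) \<Rightarrow> real ^ 'p
      \<Rightarrow> (real poly fls) ^ 'p option ^ 'p option"
  where "formal_metric u y =
    (\<chi> i j. (if i = j then 1 else 0) +
       (\<Sum>l\<in>UNIV. formal_partial i (u l) y * formal_partial j (u l) y))"

text \<open>
  The formal metric of a series as above is invertible over the ring of formal series, its constant
  term being a positive definite real matrix; so \<open>matrix_inv\<close> is a genuine inverse.
\<close>

definition formally_solves_minimal_surface_system ::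
    "nat \<Rightarrow> (real ^ 'p::finite) set \<Rightarrow> ('k::finite \<Rightarrow> real ^ 'p \<Rightarrow> real poly fls) \<Rightarrow> bool"
  where "formally_solves_minimal_surface_system n B u \<longleftrightarrow>
    (\<forall>y\<in>B. \<forall>s.
       (\<Sum>i\<in>UNIV. \<Sum>j\<in>UNIV.
          matrix_inv (formal_metric u y) $ i $ j * formal_partial i (formal_partial j (u s)) y)
       - of_nat n * fls_X_inv * formal_partial None (u s) y = 0)"

definition is_formal_series_solution ::
    "nat \<Rightarrow> (real ^ 'p::finite) set \<Rightarrow> (real ^ 'p \<Rightarrow> real ^ 'k::finite)
      \<Rightarrow> (nat \<Rightarrow> real ^ 'p \<Rightarrow> real ^ 'k) \<Rightarrow> (nat \<Rightarrow> nat \<Rightarrow> real ^ 'p \<Rightarrow> real ^ 'k) \<Rightarrow> bool"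
  where "is_formal_series_solution n B \<phi> c d \<longleftrightarrow>
    (\<forall>i\<in>{2..n}. smooth_on B (c i)) \<and>
    (\<forall>i>n. \<forall>j\<le>(i - 1) div n. smooth_on B (d i j)) \<and>
    formally_solves_minimal_surface_system n B (formal_series n \<phi> c d)"


section \<open>Mean curvature vector of a parametrized submanifold of Euclidean space\<close>

definition tangent_space_at ::
    "(real ^ 'p::finite \<Rightarrow> 'e::euclidean_space) \<Rightarrow> real ^ 'p \<Rightarrow> 'e set"
  where "tangent_space_at F y = span (range (\<lambda>\<alpha>. partial_deriv \<alpha> F y))"

definition normal_part :: "'e::euclidean_space set \<Rightarrow> 'e \<Rightarrow> 'e"
  where "normal_part T v = (THE w. w \<in> orthogonal_comp T \<and> v - w \<in> T)"

definition induced_metric ::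
    "(real ^ 'p::finite \<Rightarrow> 'e::euclidean_space) \<Rightarrow> real ^ 'p \<Rightarrow> real ^ 'p ^ 'p"
  where "induced_metric F y = (\<chi> \<alpha> \<beta>. partial_deriv \<alpha> F y \<bullet> partial_deriv \<beta> F y)"

definition second_fundamental_form ::
    "(real ^ 'p::finite \<Rightarrow> 'e::euclidean_space) \<Rightarrow> real ^ 'p \<Rightarrow> 'p \<Rightarrow> 'p \<Rightarrow> 'e"
  where "second_fundamental_form F y \<alpha> \<beta> =
    normal_part (tangent_space_at F y) (partial_deriv \<alpha> (partial_deriv \<beta> F) y)"

text \<open>Normalized by the dimension \<open>CARD('p)\<close> of the submanifold.\<close>

definition mean_curvature_vector ::
    "(real ^ 'p::finite \<Rightarrow> 'e::euclidean_space) \<Rightarrow> real ^ 'p \<Rightarrow> 'e"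
  where "mean_curvature_vector F y =
    (1 / real CARD('p)) *\<^sub>R
      (\<Sum>\<alpha>\<in>UNIV. \<Sum>\<beta>\<in>UNIV.
         matrix_inv (induced_metric F y) $ \<alpha> $ \<beta> *\<^sub>R second_fundamental_form F y \<alpha> \<beta>)"


section \<open>The graph of the leading term\<close>

text \<open>
  The hyperplane $\{y^n = 0\}$ is identified with \<open>real ^ 'p \<times> real ^ 'k\<close>, which carries the
  Euclidean inner product; the vanishing coordinate $y^n$ of $(y',0,\varphi(y'))$ is omitted.
\<close>

definition graph_param ::
    "(real ^ 'p::finite \<Rightarrow> real ^ 'k::finite) \<Rightarrow> real ^ 'p \<Rightarrow> (real ^ 'p) \<times> (real ^ 'k)"
  where "graph_param \<phi> y = (y, \<phi> y)"

definition component_gradient ::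
    "(real ^ 'p::finite \<Rightarrow> real ^ 'k::finite) \<Rightarrow> 'k \<Rightarrow> real ^ 'p \<Rightarrow> real ^ 'p"
  where "component_gradient \<phi> s y = (\<chi> \<alpha>. partial_deriv \<alpha> (\<lambda>z. \<phi> z $ s) y)"

definition graph_normal ::
    "(real ^ 'p::finite \<Rightarrow> real ^ 'k::finite) \<Rightarrow> 'k \<Rightarrow> real ^ 'p \<Rightarrow> (real ^ 'p) \<times> (real ^ 'k)"
  where "graph_normal \<phi> s y =
    (1 / sqrt (1 + (norm (component_gradient \<phi> s y))\<^sup>2)) *\<^sub>R
      (- component_gradient \<phi> s y, axis s 1)"

end

theory Submission
  imports Defs
begin

unbundle no Formal_Power_Series.fps_syntax

text \<open>
  Every series involved is a power series in $t$, and the linear term of $\mathbf{u}$ vanishes.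
  At $t = 0$ the formal metric is therefore block diagonal, with blocks $1$ and the Gram matrix
  $G$ of the graph of $\varphi$, and the constant term of the equation reads
  $G^{\alpha\beta}\partial_\alpha\partial_\beta\varphi_s + 2 c_{s,2} - 2 n\, c_{s,2} = 0$.
  On the other side, $\nu_s$ is normal, so pairing it with $\mathrm{II}_{\alpha\beta}$ is the same as
  pairing it with $(0, \partial_\alpha\partial_\beta\varphi)$.
\<close>

section \<open>Formal series without negative powers\<close>

text \<open>This is the graph of evaluation at \<open>t = 0\<close>, restricted to Laurent series
  that are power series. As a relation it carries the absence of negative powers along with the
  value, and without that absence constant terms would not be multiplicative.\<close>

definition fls_at_zero :: "'a::zero fls \<Rightarrow> 'a \<Rightarrow> bool"
  where "fls_at_zero f a \<longleftrightarrow> (\<forall>k<0. fls_nth f k = 0) \<and> fls_nth f 0 = a"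

lemma fls_at_zero_fps_to_fls: "fls_at_zero (fps_to_fls f) (fps_nth f 0)"
  by (simp add: fls_at_zero_def)

lemma fls_at_zeroE:
  assumes "fls_at_zero f a"
  obtains g where "f = fps_to_fls g" "fps_nth g 0 = a"
proof
  show "f = fps_to_fls (Abs_fps (\<lambda>k. fls_nth f (int k)))"
    using assms by (intro fls_eqI) (simp add: fls_at_zero_def)
qed (use assms in \<open>simp add: fls_at_zero_def\<close>)

lemma fls_at_zero_0: "fls_at_zero 0 0"
  by (simp add: fls_at_zero_def)

lemma fls_at_zero_1: "fls_at_zero 1 1"
  by (simp add: fls_at_zero_def)

lemma fls_at_zero_add: "fls_at_zero f a \<Longrightarrow> fls_at_zero g b \<Longrightarrow> fls_at_zero (f + g) (a + b)"
  for f g :: "'a::monoid_add fls"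
  by (simp add: fls_at_zero_def)

lemma fls_at_zero_mult:
  fixes f g :: "'a::comm_ring_1 fls"
  assumes "fls_at_zero f a" "fls_at_zero g b"
  shows "fls_at_zero (f * g) (a * b)"
proof -
  obtain f' g' where "f = fps_to_fls f'" "fps_nth f' 0 = a" "g = fps_to_fls g'" "fps_nth g' 0 = b"
    using assms by (metis fls_at_zeroE)
  then show ?thesis
    using fls_at_zero_fps_to_fls[of "f' * g'"] by (simp add: fls_times_fps_to_fls)
qed

lemma fls_at_zero_sum:
  fixes f :: "'i \<Rightarrow> 'a::ab_group_add fls"
  assumes "\<And>i. i \<in> I \<Longrightarrow> fls_at_zero (f i) (a i)"
  shows "fls_at_zero (\<Sum>i\<in>I. f i) (\<Sum>i\<in>I. a i)"
  using assms by (induction I rule: infinite_finite_induct) (auto intro: fls_at_zero_0 fls_at_zero_add)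


section \<open>Inverses of matrices of formal series\<close>

text \<open>The recursion for the coefficients of the inverse of $\sum_m A_m t^m$, where $A_0 B = 1$.\<close>

fun matrix_series_inverse ::
    "(nat \<Rightarrow> 'a::comm_ring_1 ^ 'n ^ 'n) \<Rightarrow> 'a ^ 'n ^ 'n \<Rightarrow> nat \<Rightarrow> 'a ^ 'n::finite ^ 'n"
  where "matrix_series_inverse A B m =
    B ** ((if m = 0 then mat 1 else 0) - (\<Sum>i\<in>{1..m}. A i ** matrix_series_inverse A B (m - i)))"

declare matrix_series_inverse.simps [simp del]

text \<open>Comparing coefficients of \<open>t^m\<close> in \<open>A ** C = mat 1\<close> gives a
  triangular system for the coefficients of \<open>C\<close>. A right inverse of the constant term
  alone suffices to solve it step by step.\<close>

lemma fps_matrix_right_inverse: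
  fixes A :: "'a::comm_ring_1 fps ^ 'n ^ 'n::finite"
  assumes "(\<chi> i j. fps_nth (A $ i $ j) 0) ** B = mat 1"
  obtains C where "A ** C = mat 1" "\<And>i j. fps_nth (C $ i $ j) 0 = B $ i $ j"
proof -
  define A' where "A' m = (\<chi> i j. fps_nth (A $ i $ j) m)" for m
  define b where "b = matrix_series_inverse A' B"
  define C where "C = (\<chi> i j. Abs_fps (\<lambda>m. b m $ i $ j))"
  have A0: "A' 0 ** B = mat 1"
    using assms by (simp add: A'_def)
  have conv: "(\<Sum>l=0..m. A' l ** b (m - l)) = (if m = 0 then mat 1 else 0)" for m
  proof -
    have "(\<Sum>l=0..m. A' l ** b (m - l)) = A' 0 ** b m + (\<Sum>l\<in>{1..m}. A' l ** b (m - l))"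
      by (simp add: sum.atLeast_Suc_atMost)
    \<comment> \<open>One unfolding of \<open>b m\<close> exposes the factor \<open>B\<close>, which
      \<open>A' 0\<close> cancels from the left; the remaining sum then cancels the tail of the
      Cauchy product.\<close>
    also have "A' 0 ** b m = (if m = 0 then mat 1 else 0) - (\<Sum>l\<in>{1..m}. A' l ** b (m - l))"
      unfolding b_def by (subst matrix_series_inverse.simps) (simp only: matrix_mul_assoc A0 matrix_mul_lid)
    finally show ?thesis by simp
  qed
  have "(A ** C) $ i $ j = mat 1 $ i $ j" for i j
  proof (rule fps_ext)
    fix m
    have "fps_nth ((A ** C) $ i $ j) m = (\<Sum>k\<in>UNIV. \<Sum>l=0..m. A' l $ i $ k * b (m - l) $ k $ j)"
      by (simp add: matrix_matrix_mult_def fps_sum_nth fps_mult_nth A'_def C_def)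
    also have "\<dots> = (\<Sum>l=0..m. A' l ** b (m - l)) $ i $ j"
      by (subst sum.swap) (simp add: matrix_matrix_mult_def)
    finally show "fps_nth ((A ** C) $ i $ j) m = fps_nth (mat 1 $ i $ j) m"
      by (simp add: conv mat_def)
  qed
  then have "A ** C = mat 1"
    by (simp add: vec_eq_iff)
  moreover have "b 0 = B"
    unfolding b_def by (subst matrix_series_inverse.simps) simp
  then have "fps_nth (C $ i $ j) 0 = B $ i $ j" for i j
    by (simp add: C_def)
  ultimately show thesis
    using that by blast
qed

lemma matrix_left_inverse_eq_right_inverse:
  fixes A L R :: "'a::semiring_1 ^ 'n ^ 'n::finite"
  assumes "L ** A = mat 1" and "A ** R = mat 1"
  shows "L = R"
proof -
  have "L = L ** (A ** R)"
    by (simp add: assms(2))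
  also have "\<dots> = R"
    by (simp only: matrix_mul_assoc assms(1) matrix_mul_lid)
  finally show ?thesis .
qed

text \<open>Symmetry of \<open>A\<close> turns a right inverse into a two-sided one.\<close>

lemma fls_at_zero_matrix_inv:
  fixes A :: "'a::comm_ring_1 fls ^ 'n ^ 'n::finite"
  assumes A: "\<And>i j. fls_at_zero (A $ i $ j) (A0 $ i $ j)"
    and inv: "A0 ** B = mat 1"
    and sym: "transpose A = A"
  shows "fls_at_zero (matrix_inv A $ i $ j) (B $ i $ j)"
proof -
  have "\<exists>g. A $ i $ j = fps_to_fls g \<and> fps_nth g 0 = A0 $ i $ j" for i j
    using A by (metis fls_at_zeroE)
  then obtain a where a: "\<And>i j. A $ i $ j = fps_to_fls (a i j)" "\<And>i j. fps_nth (a i j) 0 = A0 $ i $ j"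
    by metis
  have "(\<chi> i j. fps_nth ((\<chi> i j. a i j) $ i $ j) 0) = A0"
    by (simp add: a vec_eq_iff)
  then obtain C where C: "(\<chi> i j. a i j) ** C = mat 1" "\<And>i j. fps_nth (C $ i $ j) 0 = B $ i $ j"
    using inv fps_matrix_right_inverse[of "\<chi> i j. a i j" B] by metis
  define D where "D = (\<chi> i j. fps_to_fls (C $ i $ j))"
  have fps_sum: "fps_to_fls (sum f I) = (\<Sum>i\<in>I. fps_to_fls (f i))"
    for f :: "'n \<Rightarrow> 'a fps" and I
    by (induction I rule: infinite_finite_induct) auto
  have "(A ** D) $ i $ j = mat 1 $ i $ j" for i j
  proof -
    have "(A ** D) $ i $ j = fps_to_fls (((\<chi> i j. a i j) ** C) $ i $ j)"
      by (simp add: matrix_matrix_mult_def D_def a fps_sum fls_times_fps_to_fls)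
    then show ?thesis
      by (simp add: C mat_def)
  qed
  then have AD: "A ** D = mat 1"
    by (simp add: vec_eq_iff)
  have "transpose D ** A = transpose (A ** D)"
    by (simp only: matrix_transpose_mul sym)
  then have DTA: "transpose D ** A = mat 1"
    by (simp only: AD transpose_mat)
  \<comment> \<open>\<open>transpose D\<close> is a left inverse and \<open>D\<close> a right
    inverse, so they coincide and \<open>D\<close> is two-sided.\<close>
  have "transpose D = D"
    using DTA AD by (rule matrix_left_inverse_eq_right_inverse)
  with DTA have DA: "D ** A = mat 1"
    by simp
  \<comment> \<open>\<open>matrix_inv\<close> is a choice among two-sided inverses; \<open>D\<close>
    shows that there is one, and uniqueness then identifies the choice with
    \<open>D\<close>.\<close>
  have "matrix_inv A ** A = mat 1"
    unfolding matrix_inv_def by (rule someI2[of _ D]) (simp_all add: AD DA)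
  then have "matrix_inv A = D"
    using AD by (rule matrix_left_inverse_eq_right_inverse)
  then show ?thesis
    using fls_at_zero_fps_to_fls[of "C $ i $ j"] by (simp add: D_def C)
qed


section \<open>Formal partial derivatives\<close>

lemma partial_deriv_const [simp]: "partial_deriv \<alpha> (\<lambda>_. a) y = 0"
  by (simp add: partial_deriv_def)

text \<open>Tangential derivatives act coefficientwise, so they create neither negative powers nor
  logarithms in the constant term. The assumption ranges over all \<open>z\<close> because
  differentiation compares neighbouring points.\<close>

lemma fls_at_zero_formal_partial_Some:
  assumes "\<And>z. fls_at_zero (F z) [:f z:]"
  shows "fls_at_zero (formal_partial (Some \<alpha>) F y) [:partial_deriv \<alpha> f y:]"
proof -
  let ?g = "\<lambda>k. Abs_poly (\<lambda>j. partial_deriv \<alpha> (\<lambda>z. coeff (fls_nth (F z) k) j) y)"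
  have F: "fls_nth (F z) k = 0" if "k < 0" for z k
    using assms that by (simp add: fls_at_zero_def)
  have F0: "fls_nth (F z) 0 = [:f z:]" for z
    using assms by (simp add: fls_at_zero_def)
  have Abs0: "Abs_poly (\<lambda>_. 0) = (0::real poly)"
    by (simp add: zero_poly_def)
  have "?g k = 0" if "k < 0" for k
    using that by (simp add: F Abs0)
  \<comment> \<open>\<open>Abs_fls\<close> returns the given coefficients only when they vanish
    below some exponent; here the bound is 0.\<close>
  then have nth: "fls_nth (formal_partial (Some \<alpha>) F y) k = ?g k" for k
    unfolding formal_partial_def by (simp add: nth_Abs_fls_lower_bound[of 0])
  have "(\<lambda>j. partial_deriv \<alpha> (\<lambda>z. coeff (fls_nth (F z) 0) j) y)
      = coeff [:partial_deriv \<alpha> f y:]"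
    by (auto simp: F0 fun_eq_iff coeff_pCons split: nat.split)
  then have "?g 0 = [:partial_deriv \<alpha> f y:]"
    by (simp add: coeff_inverse)
  with \<open>\<And>k. k < 0 \<Longrightarrow> ?g k = 0\<close> show ?thesis
    by (simp add: fls_at_zero_def nth)
qed

text \<open>The critical exponent is \<open>k = -1\<close>: the factor \<open>k + 1\<close> vanishes
  there, and \<open>pderiv\<close> kills the constant term of \<open>F y\<close> because that term
  contains no logarithm. A term \<open>log t\<close> would produce \<open>1/t\<close>.\<close>

lemma formal_partial_None_nth:
  assumes "fls_at_zero (F y) [:a:]"
  shows "fls_nth (formal_partial None F y) k =
    of_int (k + 1) * fls_nth (F y) (k + 1) + pderiv (fls_nth (F y) (k + 1))"
proof -
  have "of_int (k + 1) * fls_nth (F y) (k + 1) + pderiv (fls_nth (F y) (k + 1)) = 0"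
    if "k < 0" for k
  proof (cases "k = -1")
    case True
    then show ?thesis using assms by (simp add: fls_at_zero_def pderiv_pCons)
  next
    case False
    then show ?thesis using assms that by (simp add: fls_at_zero_def)
  qed
  then show ?thesis
    unfolding formal_partial_def by (simp add: nth_Abs_fls_lower_bound[of 0])
qed

lemma fls_at_zero_formal_partial_None:
  assumes "fls_at_zero (F y) [:a:]"
  shows "fls_at_zero (formal_partial None F y) (fls_nth (F y) 1 + pderiv (fls_nth (F y) 1))"
proof -
  have "fls_nth (formal_partial None F y) k = 0" if "k < 0" for k
  proof (cases "k = -1")
    case True
    then show ?thesis using assms
      by (simp add: formal_partial_None_nth[of F, OF assms] fls_at_zero_def pderiv_pCons)
  next
    case False
    then show ?thesis using assms that
      by (simp add: formal_partial_None_nth[of F, OF assms] fls_at_zero_def)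
  qed
  then show ?thesis
    by (simp add: fls_at_zero_def formal_partial_None_nth[of F, OF assms])
qed

lemma sum_UNIV_option: "(\<Sum>x\<in>UNIV. f x) = f None + (\<Sum>a\<in>UNIV. f (Some a))"
  for f :: "'a::finite option \<Rightarrow> 'b::comm_monoid_add"
  by (simp add: UNIV_option_conv sum.reindex)

lemma sum_pCons_const: "(\<Sum>i\<in>I. [:f i:]) = [:\<Sum>i\<in>I. f i:]"
  for f :: "'i \<Rightarrow> 'a::comm_monoid_add"
  by (rule poly_eqI) (simp add: coeff_sum coeff_pCons split: nat.split)


section \<open>The constant term of the equation\<close>

text \<open>\<open>G\<close> is the constant term of the tangential block of the formal metric.\<close>

lemma formal_solution_second_coefficient:
  fixes \<phi> :: "real ^ 'p::finite \<Rightarrow> real ^ 'k::finite"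
    and G B :: "real ^ 'p ^ 'p"
  assumes "n \<ge> 2"
    and sol: "formally_solves_minimal_surface_system n S (formal_series n \<phi> c d)"
    and y: "y \<in> S"
    and G: "G = (\<chi> \<alpha> \<beta>. (if \<alpha> = \<beta> then 1 else 0) +
      (\<Sum>l\<in>UNIV. partial_deriv \<alpha> (\<lambda>z. \<phi> z $ l) y * partial_deriv \<beta> (\<lambda>z. \<phi> z $ l) y))"
    and GB: "G ** B = mat 1"
  shows "2 * (real n - 1) * c 2 y $ s =
    (\<Sum>\<alpha>\<in>UNIV. \<Sum>\<beta>\<in>UNIV. B $ \<alpha> $ \<beta> * partial_deriv \<alpha> (partial_deriv \<beta> (\<lambda>z. \<phi> z $ s)) y)"
proof -
  define u where "u = formal_series n \<phi> c d"
  let ?D = "\<lambda>\<alpha> l. partial_deriv \<alpha> (\<lambda>z. \<phi> z $ l)"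
  have u0: "fls_at_zero (u l z) [:\<phi> z $ l:]" for l z
    by (simp add: u_def formal_series_def fls_at_zero_def)
  have u1: "fls_nth (u l z) 1 = 0" for l z
    by (simp add: u_def formal_series_def)
  \<comment> \<open>For \<open>n \<ge> 2\<close> the exponent 2 lies in the range without
    logarithms.\<close>
  have u2: "fls_nth (u l z) 2 = [:c 2 z $ l:]" for l z
    using \<open>n \<ge> 2\<close> by (simp add: u_def formal_series_def)
  have us: "fls_at_zero (formal_partial (Some \<alpha>) (u l) z) [:?D \<alpha> l z:]" for \<alpha> l z
    using u0 by (rule fls_at_zero_formal_partial_Some)
  \<comment> \<open>The missing linear term enters here; it makes the mixed entries of the metric
    vanish at \<open>t = 0\<close>.\<close>
  have ut: "fls_at_zero (formal_partial None (u l) z) 0" for l z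
    using fls_at_zero_formal_partial_None[of "u l" z "\<phi> z $ l"] u0 by (simp add: u1)
  have ut': "fls_at_zero (formal_partial None (u l) z) [:0:]" for l z
    using ut by simp
  have ut1: "fls_nth (formal_partial None (u l) z) 1 = [:2 * c 2 z $ l:]" for l z
    using formal_partial_None_nth[of "u l" z "\<phi> z $ l" 1] u0
    by (simp add: u2 pderiv_pCons numeral_poly)
  have uss: "fls_at_zero (formal_partial (Some \<alpha>) (formal_partial (Some \<beta>) (u s)) y)
      [:partial_deriv \<alpha> (?D \<beta> s) y:]" for \<alpha> \<beta>
    using us by (rule fls_at_zero_formal_partial_Some)
  have utt: "fls_at_zero (formal_partial None (formal_partial None (u s)) y) [:2 * c 2 y $ s:]"
    using fls_at_zero_formal_partial_None[of "formal_partial None (u s)", OF ut'] by (simp add: ut1 pderiv_pCons)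
  have "fls_at_zero (formal_partial (Some \<alpha>) (formal_partial None (u s)) y) [:partial_deriv \<alpha> (\<lambda>_. 0) y:]" for \<alpha>
    using ut' by (rule fls_at_zero_formal_partial_Some)
  then have ust: "fls_at_zero (formal_partial (Some \<alpha>) (formal_partial None (u s)) y) 0" for \<alpha>
    by simp
  \<comment> \<open>Only the absence of negative powers is needed for this order of differentiation:
    the constant term \<open>w\<close> will be multiplied by a vanishing entry of
    \<open>B0\<close>.\<close>
  have uts: "\<exists>w. fls_at_zero (formal_partial None (formal_partial (Some \<beta>) (u s)) y) w" for \<beta>
    using fls_at_zero_formal_partial_None[of "formal_partial (Some \<beta>) (u s)", OF us] by blast
  then obtain w where w: "\<And>\<beta>. fls_at_zero (formal_partial None (formal_partial (Some \<beta>) (u s)) y) (w \<beta>)"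
    by metis
  \<comment> \<open>\<open>A0\<close> and \<open>B0\<close> are block diagonal with blocks 1 and
    \<open>G\<close>, respectively 1 and \<open>B\<close>, the real entries being embedded as
    polynomials constant in \<open>log t\<close>.\<close>
  define A0 :: "real poly ^ 'p option ^ 'p option" where
    "A0 = (\<chi> i j. case i of None \<Rightarrow> (if j = None then 1 else 0)
       | Some \<alpha> \<Rightarrow> (case j of None \<Rightarrow> 0 | Some \<beta> \<Rightarrow> [:G $ \<alpha> $ \<beta>:]))"
  define B0 :: "real poly ^ 'p option ^ 'p option" where
    "B0 = (\<chi> i j. case i of None \<Rightarrow> (if j = None then 1 else 0)
       | Some \<alpha> \<Rightarrow> (case j of None \<Rightarrow> 0 | Some \<beta> \<Rightarrow> [:B $ \<alpha> $ \<beta>:]))"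
  define M where "M = formal_metric u y"
  have M: "fls_at_zero (M $ i $ j) (A0 $ i $ j)" for i j
  proof -
    let ?v = "\<lambda>i l. case i of None \<Rightarrow> 0 | Some \<alpha> \<Rightarrow> [:?D \<alpha> l y:]"
    have v: "fls_at_zero (formal_partial i (u l) y) (?v i l)" for i l
      using us ut by (simp split: option.split)
    have "fls_at_zero (if i = j then 1 else 0 :: real poly fls) (if i = j then 1 else 0)"
      by (simp add: fls_at_zero_0 fls_at_zero_1)
    then have "fls_at_zero (M $ i $ j) ((if i = j then 1 else 0) + (\<Sum>l\<in>UNIV. ?v i l * ?v j l))"
      unfolding M_def formal_metric_def
      by (auto simp del: mult_pCons_left intro!: fls_at_zero_add fls_at_zero_sum fls_at_zero_mult v)
    moreover have "(if i = j then 1 else 0) + (\<Sum>l\<in>UNIV. ?v i l * ?v j l) = A0 $ i $ j"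
      by (cases i; cases j) (auto simp: A0_def G sum_pCons_const one_pCons mult.commute)
    ultimately show ?thesis by simp
  qed
  have "(A0 ** B0) $ i $ j = mat 1 $ i $ j" for i j
  proof -
    have "(\<Sum>\<gamma>\<in>UNIV. G $ \<alpha> $ \<gamma> * B $ \<gamma> $ \<beta>) = (if \<alpha> = \<beta> then 1 else 0)" for \<alpha> \<beta>
      using GB by (simp add: matrix_matrix_mult_def mat_def vec_eq_iff)
    then show ?thesis
      by (cases i; cases j)
        (auto simp: matrix_matrix_mult_def mat_def A0_def B0_def sum_UNIV_option sum_pCons_const one_pCons)
  qed
  then have AB: "A0 ** B0 = mat 1"
    by (simp add: vec_eq_iff)
  have "transpose M = M"
    by (simp add: M_def formal_metric_def transpose_def vec_eq_iff mult.commute eq_commute)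
  then have I: "fls_at_zero (matrix_inv M $ i $ j) (B0 $ i $ j)" for i j
    using fls_at_zero_matrix_inv[OF M AB] by blast
  let ?T = "\<lambda>i j. matrix_inv M $ i $ j * formal_partial i (formal_partial j (u s)) y"
  let ?t = "\<lambda>i j. case i of
      None \<Rightarrow> (case j of None \<Rightarrow> [:2 * c 2 y $ s:] | Some \<beta> \<Rightarrow> 0)
    | Some \<alpha> \<Rightarrow> (case j of None \<Rightarrow> 0 | Some \<beta> \<Rightarrow> [:B $ \<alpha> $ \<beta> * partial_deriv \<alpha> (?D \<beta> s) y:])"
  have "fls_at_zero (?T i j) (?t i j)" for i j
  proof -
    have "fls_at_zero (?T (Some \<alpha>) (Some \<beta>)) ([:B $ \<alpha> $ \<beta>:] * [:partial_deriv \<alpha> (?D \<beta> s) y:])" for \<alpha> \<beta>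
      using I[of "Some \<alpha>" "Some \<beta>"] by (intro fls_at_zero_mult uss) (simp add: B0_def)
    moreover have "fls_at_zero (?T (Some \<alpha>) None) (0 * 0)" for \<alpha>
      using I[of "Some \<alpha>" None] by (intro fls_at_zero_mult ust) (simp add: B0_def)
    moreover have "fls_at_zero (?T None (Some \<beta>)) (0 * w \<beta>)" for \<beta>
      using I[of None "Some \<beta>"] by (intro fls_at_zero_mult w) (simp add: B0_def)
    moreover have "fls_at_zero (?T None None) (1 * [:2 * c 2 y $ s:])"
      using I[of None None] by (intro fls_at_zero_mult utt) (simp add: B0_def)
    ultimately show ?thesis
      by (cases i; cases j) (simp_all add: mult.commute)
  qed
  then have "fls_at_zero (\<Sum>i\<in>UNIV. \<Sum>j\<in>UNIV. ?T i j) (\<Sum>i\<in>UNIV. \<Sum>j\<in>UNIV. ?t i j)"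
    by (intro fls_at_zero_sum)
  moreover have "(\<Sum>i\<in>UNIV. \<Sum>j\<in>UNIV. ?T i j)
      = of_nat n * fls_X_inv * formal_partial None (u s) y"
    using sol y by (simp add: formally_solves_minimal_surface_system_def u_def M_def)
  \<comment> \<open>Division by \<open>t\<close> shifts indices, so the constant term is
    \<open>n\<close> times the linear coefficient of the normal derivative.\<close>
  moreover have "fls_nth (of_nat n * fls_X_inv * formal_partial None (u s) y) 0
      = [:real n * (2 * c 2 y $ s):]"
    by (simp add: mult.assoc fls_X_inv_times_conv_shift(1) fls_mult_of_nat_nth ut1 of_nat_poly)
  ultimately have "[:real n * (2 * c 2 y $ s):] = (\<Sum>i\<in>UNIV. \<Sum>j\<in>UNIV. ?t i j)"
    by (simp add: fls_at_zero_def)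
  then show ?thesis
    by (simp add: sum_UNIV_option sum_pCons_const algebra_simps)
qed


section \<open>The geometry of the graph\<close>

text \<open>The removed part \<open>v - normal_part T v\<close> lies in \<open>T\<close> and so
  pairs to zero with \<open>\<nu>\<close>. Most of the proof shows that the definite description is
  meaningful, by existence and uniqueness of the orthogonal decomposition.\<close>

lemma inner_normal_part:
  assumes "subspace T" and \<nu>: "\<And>x. x \<in> T \<Longrightarrow> x \<bullet> \<nu> = 0"
  shows "normal_part T v \<bullet> \<nu> = v \<bullet> \<nu>"
proof -
  have span: "span T = T"
    using \<open>subspace T\<close> by (simp add: span_eq_iff)
  have "\<exists>!w. w \<in> orthogonal_comp T \<and> v - w \<in> T"
  proof (rule ex_ex1I)
    obtain x z where "x \<in> span T" "\<And>w. w \<in> span T \<Longrightarrow> orthogonal z w" "v = x + z"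
      using orthogonal_subspace_decomp_exists[of T v] by metis
    then show "\<exists>w. w \<in> orthogonal_comp T \<and> v - w \<in> T"
      by (intro exI[of _ z]) (auto simp: span orthogonal_comp_def orthogonal_commute)
  next
    fix w z
    assume w: "w \<in> orthogonal_comp T \<and> v - w \<in> T" and z: "z \<in> orthogonal_comp T \<and> v - z \<in> T"
    then have "(v - z) - (v - w) \<in> T"
      using \<open>subspace T\<close> by (metis subspace_diff)
    moreover have "w - z \<in> orthogonal_comp T"
      using w z by (metis subspace_diff subspace_orthogonal_comp)
    ultimately have "orthogonal (w - z) (w - z)"
      by (simp add: orthogonal_comp_def)
    then show "w = z"
      by (simp add: orthogonal_self)
  qed
  then have "normal_part T v \<in> orthogonal_comp T \<and> v - normal_part T v \<in> T"
    unfolding normal_part_def by (rule theI')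
  then have "(v - normal_part T v) \<bullet> \<nu> = 0"
    using \<nu> by blast
  then show ?thesis
    by (simp add: inner_diff_left)
qed

section \<open>Partial derivatives of the graph parametrization\<close>

lemma smooth_on_differentiable: "smooth_on S f \<Longrightarrow> y \<in> S \<Longrightarrow> f differentiable (at y)"
  unfolding smooth_on_def by (metis Ck_on.simps(2))

lemma smooth_on_partial_deriv:
  assumes "smooth_on S f" shows "smooth_on S (partial_deriv \<alpha> f)"
proof -
  have "Ck_on k S (partial_deriv \<alpha> f)" for k
    using assms Ck_on.simps(2)[of k S f] by (auto simp: smooth_on_def partial_deriv_def[abs_def])
  then show ?thesis
    by (simp add: smooth_on_def)
qed

text \<open>Formulas for first derivatives hold only on the open set where \<open>\<phi>\<close> is
  smooth; locality of the derivative allows them to be differentiated again.\<close>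

lemma partial_deriv_cong_open:
  assumes "g differentiable (at y)" "open S" "y \<in> S" "\<And>z. z \<in> S \<Longrightarrow> f z = g z"
  shows "partial_deriv \<alpha> f y = partial_deriv \<alpha> g y"
  using frechet_derivative_transform_within_open[OF assms(1-3), of f] assms(4)
  by (simp add: partial_deriv_def)

lemma partial_deriv_vec_nth:
  fixes f :: "real ^ 'p::finite \<Rightarrow> real ^ 'k::finite"
  assumes "f differentiable (at y)"
  shows "partial_deriv \<alpha> (\<lambda>z. f z $ s) y = partial_deriv \<alpha> f y $ s"
proof -
  have "((\<lambda>z. f z $ s) has_derivative (\<lambda>h. frechet_derivative f (at y) h $ s)) (at y)"
    using assms bounded_linear_vec_nth bounded_linear.has_derivative frechet_derivative_works by blast
  from frechet_derivative_at[OF this] show ?thesis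
    unfolding partial_deriv_def by metis
qed

lemma partial_deriv_Pair:
  assumes "(f has_derivative f') (at y)" "g differentiable (at y)"
  shows "partial_deriv \<alpha> (\<lambda>z. (f z, g z)) y = (f' (axis \<alpha> 1), partial_deriv \<alpha> g y)"
proof -
  have "((\<lambda>z. (f z, g z)) has_derivative (\<lambda>h. (f' h, frechet_derivative g (at y) h))) (at y)"
    using assms by (intro has_derivative_Pair) (auto simp: frechet_derivative_works)
  from frechet_derivative_at[OF this] show ?thesis
    unfolding partial_deriv_def by metis
qed

lemma partial_deriv_graph_param:
  assumes "\<phi> differentiable (at y)"
  shows "partial_deriv \<alpha> (graph_param \<phi>) y = (axis \<alpha> 1, partial_deriv \<alpha> \<phi> y)"
  unfolding graph_param_def[abs_def] using assms by (intro partial_deriv_Pair) auto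

text \<open>The base component has the constant first derivative \<open>axis \<beta> 1\<close>, so
  only \<open>\<phi>\<close> contributes at second order.\<close>

lemma second_partial_deriv_graph_param:
  assumes "smooth_on S \<phi>" "open S" "y \<in> S"
  shows "partial_deriv \<alpha> (partial_deriv \<beta> (graph_param \<phi>)) y
    = (0, partial_deriv \<alpha> (partial_deriv \<beta> \<phi>) y)"
proof -
  let ?g = "\<lambda>z. (axis \<beta> 1 :: real ^ 'a, partial_deriv \<beta> \<phi> z)"
  have d: "partial_deriv \<beta> \<phi> differentiable (at y)"
    using assms smooth_on_differentiable smooth_on_partial_deriv by blast
  then have g: "partial_deriv \<alpha> ?g y = (0, partial_deriv \<alpha> (partial_deriv \<beta> \<phi>) y)"
    by (intro partial_deriv_Pair) auto
  have "?g differentiable (at y)"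
    using d has_derivative_Pair[OF has_derivative_const] unfolding differentiable_def by fast
  moreover have "partial_deriv \<beta> (graph_param \<phi>) z = ?g z" if "z \<in> S" for z
    using smooth_on_differentiable[OF assms(1) that] by (rule partial_deriv_graph_param)
  ultimately have "partial_deriv \<alpha> (partial_deriv \<beta> (graph_param \<phi>)) y = partial_deriv \<alpha> ?g y"
    using assms(2,3) by (intro partial_deriv_cong_open)
  with g show ?thesis by simp
qed

lemma second_partial_deriv_vec_nth:
  fixes \<phi> :: "real ^ 'p::finite \<Rightarrow> real ^ 'k::finite"
  assumes "smooth_on S \<phi>" "open S" "y \<in> S"
  shows "partial_deriv \<alpha> (partial_deriv \<beta> (\<lambda>z. \<phi> z $ s)) y
    = partial_deriv \<alpha> (partial_deriv \<beta> \<phi>) y $ s"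
proof -
  have d: "partial_deriv \<beta> \<phi> differentiable (at y)"
    using assms smooth_on_differentiable smooth_on_partial_deriv by blast
  have "(\<lambda>z. partial_deriv \<beta> \<phi> z $ s) differentiable (at y)"
    using d bounded_linear.has_derivative[OF bounded_linear_vec_nth] unfolding differentiable_def by fast
  then have "partial_deriv \<alpha> (partial_deriv \<beta> (\<lambda>z. \<phi> z $ s)) y
      = partial_deriv \<alpha> (\<lambda>z. partial_deriv \<beta> \<phi> z $ s) y"
    using assms partial_deriv_vec_nth smooth_on_differentiable
    by (intro partial_deriv_cong_open) blast+
  then show ?thesis
    using d by (simp add: partial_deriv_vec_nth)
qed

section \<open>Gram matrix and mean curvature of the graph\<close>

text \<open>The right-hand side has the shape of \<open>G\<close> in
  \<open>formal_solution_second_coefficient\<close>, so the formal system and the geometry of the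
  graph share one matrix.\<close>

lemma induced_metric_graph_param:
  fixes \<phi> :: "real ^ 'p::finite \<Rightarrow> real ^ 'k::finite"
  assumes "\<phi> differentiable (at y)"
  shows "induced_metric (graph_param \<phi>) y = (\<chi> \<alpha> \<beta>. (if \<alpha> = \<beta> then 1 else 0) +
      (\<Sum>l\<in>UNIV. partial_deriv \<alpha> (\<lambda>z. \<phi> z $ l) y * partial_deriv \<beta> (\<lambda>z. \<phi> z $ l) y))"
  using assms
  by (simp add: induced_metric_def partial_deriv_graph_param partial_deriv_vec_nth vec_eq_iff
      inner_vec_def[of "partial_deriv _ _ _"] inner_axis_axis)

text \<open>A Gram matrix has trivial kernel when its vectors are independent, and the tangent
  vectors of a graph are independent already in their base components.\<close>

lemma induced_metric_graph_param_invertible: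
  fixes \<phi> :: "real ^ 'p::finite \<Rightarrow> real ^ 'k::finite"
  assumes "\<phi> differentiable (at y)"
  shows "invertible (induced_metric (graph_param \<phi>) y)"
proof -
  let ?G = "induced_metric (graph_param \<phi>) y"
  let ?F = "\<lambda>x. \<Sum>\<beta>\<in>UNIV. x $ \<beta> *\<^sub>R partial_deriv \<beta> (graph_param \<phi>) y"
  have "x = 0" if "?G *v x = 0" for x
  proof -
    \<comment> \<open>The quadratic form is the squared length of \<open>?F x\<close>, whose base
      component is \<open>x\<close> itself.\<close>
    have "x \<bullet> (?G *v x) = ?F x \<bullet> ?F x"
      by (simp add: inner_vec_def[of x] matrix_vector_mult_def induced_metric_def inner_sum_left
          inner_sum_right sum_distrib_left mult_ac inner_commute)
    then have "fst (?F x) = 0"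
      using that by simp
    then have "(\<Sum>\<beta>\<in>UNIV. x $ \<beta> *\<^sub>R (axis \<beta> 1 :: real ^ 'p)) = 0"
      using assms by (simp add: fst_sum partial_deriv_graph_param)
    then show "x = 0"
      using basis_expansion[of x] by (simp add: scalar_mult_eq_scaleR)
  qed
  then show ?thesis
    by (metis invertible_left_inverse matrix_left_invertible_ker)
qed

text \<open>Multiplying by the root replaces the unit normal by the unnormalized \<open>N\<close>.
  Since \<open>N\<close> is normal, projection in the second fundamental form does not affect the
  pairing, and \<open>N\<close> reads off the component \<open>s\<close> of the second derivatives
  of \<open>\<phi>\<close>.\<close>

lemma mean_curvature_inner_graph_normal:
  fixes \<phi> :: "real ^ 'p::finite \<Rightarrow> real ^ 'k::finite"
  assumes "smooth_on S \<phi>" "open S" "y \<in> S"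
  shows "sqrt (1 + (norm (component_gradient \<phi> s y))\<^sup>2)
      * (mean_curvature_vector (graph_param \<phi>) y \<bullet> graph_normal \<phi> s y)
    = 1 / real CARD('p) * (\<Sum>\<alpha>\<in>UNIV. \<Sum>\<beta>\<in>UNIV. matrix_inv (induced_metric (graph_param \<phi>) y) $ \<alpha> $ \<beta>
        * partial_deriv \<alpha> (partial_deriv \<beta> (\<lambda>z. \<phi> z $ s)) y)"
proof -
  define N where "N = (- component_gradient \<phi> s y, axis s 1 :: real ^ 'k)"
  have d: "\<phi> differentiable (at y)"
    using assms smooth_on_differentiable by blast
  \<comment> \<open>The two components contribute minus and plus the same derivative of the
    \<open>s\<close>-th component of \<open>\<phi>\<close>.\<close>
  have "partial_deriv \<alpha> (graph_param \<phi>) y \<bullet> N = 0" for \<alpha>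
    using d by (simp add: N_def partial_deriv_graph_param component_gradient_def
        partial_deriv_vec_nth inner_axis inner_axis')
  then have "tangent_space_at (graph_param \<phi>) y \<subseteq> {x. N \<bullet> x = 0}"
    unfolding tangent_space_at_def
    by (intro span_minimal subspace_hyperplane) (auto simp: inner_commute)
  then have tangent: "x \<bullet> N = 0" if "x \<in> tangent_space_at (graph_param \<phi>) y" for x
    using that by (auto simp: inner_commute)
  have "subspace (tangent_space_at (graph_param \<phi>) y)"
    by (simp add: tangent_space_at_def)
  then have II: "second_fundamental_form (graph_param \<phi>) y \<alpha> \<beta> \<bullet> N
      = partial_deriv \<alpha> (partial_deriv \<beta> (\<lambda>z. \<phi> z $ s)) y" for \<alpha> \<beta>
    using assms tangent unfolding second_fundamental_form_def
    by (simp add: inner_normal_part second_partial_deriv_graph_param second_partial_deriv_vec_nth)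
      (simp add: N_def inner_axis)
  have "sqrt (1 + (norm (component_gradient \<phi> s y))\<^sup>2) \<noteq> 0"
    using zero_le_power2[of "norm (component_gradient \<phi> s y)"] by (simp add: add_nonneg_eq_0_iff)
  then have "sqrt (1 + (norm (component_gradient \<phi> s y))\<^sup>2) *\<^sub>R graph_normal \<phi> s y = N"
    by (simp add: graph_normal_def N_def)
  then have "sqrt (1 + (norm (component_gradient \<phi> s y))\<^sup>2)
      * (mean_curvature_vector (graph_param \<phi>) y \<bullet> graph_normal \<phi> s y)
    = mean_curvature_vector (graph_param \<phi>) y \<bullet> N"
    by (metis inner_scaleR_right)
  then show ?thesis
    by (simp add: mean_curvature_vector_def inner_sum_left II)
qed

theorem lemma6p1:
  fixes n m :: nat
    and r :: real
    and \<phi> :: "real ^ 'p::finite \<Rightarrow> real ^ 'k::finite"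
    and c :: "nat \<Rightarrow> real ^ 'p \<Rightarrow> real ^ 'k"
    and d :: "nat \<Rightarrow> nat \<Rightarrow> real ^ 'p \<Rightarrow> real ^ 'k"
  assumes "n \<ge> 2" and "m > n"
    and "CARD('p) = n - 1" and "CARD('k) = m - n"
    and "r > 0"
    and "smooth_on (ball 0 r) \<phi>"
    and "is_formal_series_solution n (ball 0 r) \<phi> c d"
  shows "\<forall>y\<in>ball 0 r. \<forall>s.
    c 2 y $ s =
      1 / 2 * sqrt (1 + (norm (component_gradient \<phi> s y))\<^sup>2)
        * (mean_curvature_vector (graph_param \<phi>) y \<bullet> graph_normal \<phi> s y)"
proof (intro ballI allI)
  fix y :: "real ^ 'p" and s :: 'k
  assume y: "y \<in> ball 0 r"
  let ?G = "induced_metric (graph_param \<phi>) y"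
  have d: "\<phi> differentiable (at y)"
    using assms(6) y by (rule smooth_on_differentiable)
  have sol: "formally_solves_minimal_surface_system n (ball 0 r) (formal_series n \<phi> c d)"
    using assms(7) by (simp add: is_formal_series_solution_def)
  have inv: "?G ** matrix_inv ?G = mat 1"
    using induced_metric_graph_param_invertible[OF d] unfolding matrix_inv_def invertible_def
    by (rule someI2_ex) blast
  \<comment> \<open>The factor \<open>n - 1\<close> from the formal equation is the dimension of the
    graph, so it cancels against the normalization of the mean curvature.\<close>
  have card: "real n - 1 = real CARD('p)"
    using assms(1,3) by simp
  note coeff = formal_solution_second_coefficient
    [OF assms(1) sol y induced_metric_graph_param[OF d] inv, of s, unfolded card]
  have "sqrt (1 + (norm (component_gradient \<phi> s y))\<^sup>2)
      * (mean_curvature_vector (graph_param \<phi>) y \<bullet> graph_normal \<phi> s y) = 2 * c 2 y $ s"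
    using mean_curvature_inner_graph_normal[OF assms(6) open_ball y, of s, folded coeff] by simp
  then show "c 2 y $ s =
      1 / 2 * sqrt (1 + (norm (component_gradient \<phi> s y))\<^sup>2)
        * (mean_curvature_vector (graph_param \<phi>) y \<bullet> graph_normal \<phi> s y)"
    by simp
qed

end
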